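(* Let $a<b$ be real numbers and let $n\in\mathbb{N}$, $n\ge 1$. If $f\in\mathcal{C}^{2,2}[a,b]$, then $$\big|R[S_{2n}^{+};f]\big|\leq \Big(\frac{1}{2}+\frac{1}{4(2n-1)}\Big)\,\big|R[S_{n}^{+};f]\big|$$ and $$\big|R[S_{2n}^{+};f]\big|\leq \frac{4n-1}{4n-3}\,\big|S_{2n}^{+}[f]-S_{n}^{+}[f]\big|.$$
   Context: Write $[a,b]^2=[a,b]\times[a,b]$ and $D^{i,j}f=\frac{\partial^{i+j}f}{\partial x^i\partial y^j}$. Let $C^{2,2}([a,b]^2)$ be the set of functions $f:[a,b]^2\to\mathbb{R}$ such that $D^{i,j}f$ is continuous in $[a,b]^2$ for all $0\le i\le 2$, $0\le j\le 2$, and let $$\mathcal{C}^{2,2}[a,b]=\{f\in C^{2,2}([a,b]^2): D^{2,2}f \text{ does not change sign in } (a,b)^2\}$$ (that is, either $D^{2,2}f\ge 0$ throughout $(a,b)^2$ or $D^{2,2}f\le 0$ throughout $(a,b)^2$). For $n\ge1$ put $h_n=\frac{b-a}{n}$ and $x_{i,n}=y_{i,n}=a+ih_n$, $i=0,\ldots,n$. A primed sum $\sum_{i=0}^{n}{}^{\prime}$ means that the first and the last summands (those with $i=0$ and $i=n$) are halved. The $n$-th composite trapezium rule for a univariate function $g$ on $[a,b]$ and its remainder are $$Q_n^{Tr}[g]=h_n\sum_{i=0}^{n}{}^{\prime}\,g(x_{i,n}),\qquad R[Q_n^{Tr};g]=\int_a^b g(t)\,dt-Q_n^{Tr}[g].$$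 The product trapezium cubature rule is $$C_n^{Tr}[f]=h_n^2\sum_{i=0}^{n}{}^{\prime}\sum_{j=0}^{n}{}^{\prime}f(x_{i,n},y_{j,n}).$$ For $f$ defined on $[a,b]^2$ set $f_l(t)=f(a,t)$, $f_r(t)=f(b,t)$, $f_d(t)=f(t,a)$, $f_u(t)=f(t,b)$, $t\in[a,b]$. The modified product trapezoidal rule $S_n^{+}$ is $$S_n^{+}[f]=C_n^{Tr}[f]+\frac{b-a}{2}\Big(R[Q_n^{Tr};f_l]+R[Q_n^{Tr};f_r]+R[Q_n^{Tr};f_d]+R[Q_n^{Tr};f_u]\Big),$$ and its remainder is $R[S_n^{+};f]=I[f]-S_n^{+}[f]$, where $I[f]=\iint_{[a,b]^2}f(x,y)\,dx\,dy$. *)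

theory Defs
  imports "HOL-Analysis.Analysis"
begin

text \<open>
  A function on the square \<open>[a,b]\<^sup>2\<close> is a total function on \<^typ>\<open>real \<times> real\<close>; only its
  values on the square matter. Derivatives are taken within \<^term>\<open>{a..b}\<close>, hence are one-sided
  on the boundary.
\<close>

definition square :: "real \<Rightarrow> real \<Rightarrow> (real \<times> real) set" where
  "square a b = {a..b} \<times> {a..b}"

definition partial_x :: "real \<Rightarrow> real \<Rightarrow> (real \<times> real \<Rightarrow> real) \<Rightarrow> real \<times> real \<Rightarrow> real" where
  "partial_x a b g = (\<lambda>(x, y). vector_derivative (\<lambda>t. g (t, y)) (at x within {a..b}))"

definition partial_y :: "real \<Rightarrow> real \<Rightarrow> (real \<times> real \<Rightarrow> real) \<Rightarrow> real \<times> real \<Rightarrow> real" where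
  "partial_y a b g = (\<lambda>(x, y). vector_derivative (\<lambda>t. g (x, t)) (at y within {a..b}))"

definition x_differentiable :: "real \<Rightarrow> real \<Rightarrow> (real \<times> real \<Rightarrow> real) \<Rightarrow> bool" where
  "x_differentiable a b g \<longleftrightarrow>
     (\<forall>x\<in>{a..b}. \<forall>y\<in>{a..b}. (\<lambda>t. g (t, y)) differentiable (at x within {a..b}))"

definition y_differentiable :: "real \<Rightarrow> real \<Rightarrow> (real \<times> real \<Rightarrow> real) \<Rightarrow> bool" where
  "y_differentiable a b g \<longleftrightarrow>
     (\<forall>x\<in>{a..b}. \<forall>y\<in>{a..b}. (\<lambda>t. g (x, t)) differentiable (at y within {a..b}))"

text \<open>
  \<open>mixed_deriv a b i j f\<close> is \<open>D\<^bsup>i,j\<^esup> f = \<partial>\<^bsup>i+j\<^esup> f / \<partial>x\<^sup>i \<partial>y\<^sup>j\<close>: first \<open>j\<close> derivatives in \<open>y\<close>, then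
  \<open>i\<close> in \<open>x\<close>. It is meaningful on the square when \<open>mixed_deriv_exists a b i j f\<close> holds, i.e. when
  every derivative taken on the way exists.
\<close>

definition mixed_deriv ::
    "real \<Rightarrow> real \<Rightarrow> nat \<Rightarrow> nat \<Rightarrow> (real \<times> real \<Rightarrow> real) \<Rightarrow> real \<times> real \<Rightarrow> real" where
  "mixed_deriv a b i j f = (partial_x a b ^^ i) ((partial_y a b ^^ j) f)"

definition mixed_deriv_exists ::
    "real \<Rightarrow> real \<Rightarrow> nat \<Rightarrow> nat \<Rightarrow> (real \<times> real \<Rightarrow> real) \<Rightarrow> bool" where
  "mixed_deriv_exists a b i j f \<longleftrightarrow>
     (\<forall>l<j. y_differentiable a b (mixed_deriv a b 0 l f)) \<and>
     (\<forall>k<i. x_differentiable a b (mixed_deriv a b k j f))"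

definition C22 :: "real \<Rightarrow> real \<Rightarrow> (real \<times> real \<Rightarrow> real) set" where
  "C22 a b = {f. \<forall>i\<le>2. \<forall>j\<le>2. mixed_deriv_exists a b i j f \<and>
                   continuous_on (square a b) (mixed_deriv a b i j f)}"

definition C22_one_sign :: "real \<Rightarrow> real \<Rightarrow> (real \<times> real \<Rightarrow> real) set" where
  "C22_one_sign a b = {f \<in> C22 a b.
     (\<forall>p\<in>{a<..<b} \<times> {a<..<b}. mixed_deriv a b 2 2 f p \<ge> 0) \<or>
     (\<forall>p\<in>{a<..<b} \<times> {a<..<b}. mixed_deriv a b 2 2 f p \<le> 0)}"

definition mesh :: "real \<Rightarrow> real \<Rightarrow> nat \<Rightarrow> real" where
  "mesh a b n = (b - a) / real n"

definition node :: "real \<Rightarrow> real \<Rightarrow> nat \<Rightarrow> nat \<Rightarrow> real" where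
  "node a b n i = a + real i * mesh a b n"

definition primed_sum :: "nat \<Rightarrow> (nat \<Rightarrow> real) \<Rightarrow> real" where
  "primed_sum n F = (\<Sum>i=0..n. if i = 0 \<or> i = n then F i / 2 else F i)"

definition trapezium :: "real \<Rightarrow> real \<Rightarrow> nat \<Rightarrow> (real \<Rightarrow> real) \<Rightarrow> real" where
  "trapezium a b n g = mesh a b n * primed_sum n (\<lambda>i. g (node a b n i))"

definition trapezium_remainder :: "real \<Rightarrow> real \<Rightarrow> nat \<Rightarrow> (real \<Rightarrow> real) \<Rightarrow> real" where
  "trapezium_remainder a b n g = integral {a..b} g - trapezium a b n g"

definition product_trapezium :: "real \<Rightarrow> real \<Rightarrow> nat \<Rightarrow> (real \<times> real \<Rightarrow> real) \<Rightarrow> real" where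
  "product_trapezium a b n f =
     (mesh a b n)\<^sup>2 *
       primed_sum n (\<lambda>i. primed_sum n (\<lambda>j. f (node a b n i, node a b n j)))"

definition S_plus :: "real \<Rightarrow> real \<Rightarrow> nat \<Rightarrow> (real \<times> real \<Rightarrow> real) \<Rightarrow> real" where
  "S_plus a b n f = product_trapezium a b n f + (b - a) / 2 *
     (trapezium_remainder a b n (\<lambda>t. f (a, t)) + trapezium_remainder a b n (\<lambda>t. f (b, t)) +
      trapezium_remainder a b n (\<lambda>t. f (t, a)) + trapezium_remainder a b n (\<lambda>t. f (t, b)))"

definition S_plus_remainder :: "real \<Rightarrow> real \<Rightarrow> nat \<Rightarrow> (real \<times> real \<Rightarrow> real) \<Rightarrow> real" where
  "S_plus_remainder a b n f = integral (square a b) f - S_plus a b n f"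

end

theory Submission
  imports Defs
begin

text \<open>
  With \<open>R\<^sub>n\<close> the remainder of the trapezium rule, acting on either variable, the remainder of
  \<open>S\<^sub>n\<^sup>+\<close> factors as \<open>R\<^sub>1 \<otimes> R\<^sub>n + R\<^sub>n \<otimes> R\<^sub>1 - R\<^sub>n \<otimes> R\<^sub>n\<close>. Since \<open>R\<^sub>n[g] = - \<integral> k\<^sub>n g''\<close> with a
  kernel \<open>k\<^sub>n \<ge> 0\<close>, it is the integral of \<open>D\<^bsup>2,2\<^esup>f\<close> against
  \<open>W\<^sub>n(s,t) = k\<^sub>1(s) k\<^sub>n(t) + k\<^sub>n(s) k\<^sub>1(t) - k\<^sub>n(s) k\<^sub>n(t)\<close>. From \<open>k\<^sub>2\<^sub>n \<le> k\<^sub>n / 2\<close> and \<open>n k\<^sub>n \<le> k\<^sub>1\<close> one gets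
  \<open>0 \<le> W\<^sub>2\<^sub>n \<le> c W\<^sub>n\<close> with \<open>c = 1/2 + 1/(4(2n-1))\<close>, which yields the first estimate; the second one
  follows from it by the triangle inequality, as \<open>c/(1-c) = (4n-1)/(4n-3)\<close>.
\<close>

section \<open>Nodes of the composite rule and bounds for its Peano kernel\<close>

text \<open>
  The \<open>i\<close>-th product is positive only inside the \<open>i\<close>-th cell, so at most one summand is nonzero.
\<close>
definition peano_kernel :: "real \<Rightarrow> real \<Rightarrow> nat \<Rightarrow> real \<Rightarrow> real" where
  "peano_kernel a b n t = (\<Sum>i<n. max 0 ((t - node a b n i) * (node a b n (Suc i) - t))) / 2"

lemma node_0: "node a b n 0 = a"
  by (simp add: node_def)

lemma node_last: "n \<ge> 1 \<Longrightarrow> node a b n n = b"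
  by (simp add: node_def mesh_def)

lemma node_Suc: "node a b n (Suc i) = node a b n i + mesh a b n"
  by (simp add: node_def algebra_simps)

lemma mesh_pos: "a < b \<Longrightarrow> n \<ge> 1 \<Longrightarrow> 0 < mesh a b n"
  by (simp add: mesh_def)

lemma node_mono:
  assumes "a < b" "n \<ge> 1" "i \<le> j"
  shows "node a b n i \<le> node a b n j"
  using assms mesh_pos[of a b n] by (auto simp: node_def intro!: mult_right_mono)

lemma node_mem:
  assumes "a < b" "n \<ge> 1" "i \<le> n"
  shows "node a b n i \<in> {a..b}"
  using node_mono[of a b n 0 i] node_mono[of a b n i n] node_last[of n a b] assms
  by (simp add: node_0)

lemma continuous_on_peano_kernel: "continuous_on S (peano_kernel a b n)"
  unfolding peano_kernel_def by (intro continuous_intros) simp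

lemma peano_kernel_nonneg: "peano_kernel a b n t \<ge> 0"
  unfolding peano_kernel_def by (simp add: sum_nonneg)

text \<open>A point of cell \<open>i\<close> lies weakly on one side of both end nodes of any other
  cell, so the product of that cell is nonpositive and \<open>max\<close> discards it. At a node
  shared by two cells both products vanish, so closed cells cause no conflict.\<close>

lemma peano_kernel_cell:
  assumes "a < b" "n \<ge> 1" "i < n" and t: "node a b n i \<le> t" "t \<le> node a b n (Suc i)"
  shows "peano_kernel a b n t = (t - node a b n i) * (node a b n (Suc i) - t) / 2"
proof -
  have "max 0 ((t - node a b n j) * (node a b n (Suc j) - t)) = 0" if "j < n" "j \<noteq> i" for j
  proof (cases "j < i")
    case True
    then have "node a b n j \<le> node a b n i" "node a b n (Suc j) \<le> node a b n i"
      using node_mono assms by auto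
    with t show ?thesis by (simp add: mult_nonneg_nonpos)
  next
    case False
    with that have "node a b n (Suc i) \<le> node a b n j" "node a b n (Suc i) \<le> node a b n (Suc j)"
      using node_mono assms by auto
    with t show ?thesis by (simp add: mult_nonpos_nonneg)
  qed
  then have "(\<Sum>j<n. max 0 ((t - node a b n j) * (node a b n (Suc j) - t)))
      = (\<Sum>j<n. if j = i then (t - node a b n i) * (node a b n (Suc i) - t) else 0)"
    using t by (intro sum.cong) auto
  with \<open>i < n\<close> show ?thesis
    by (simp add: peano_kernel_def)
qed

lemma cell_exists:
  assumes "a < b" "n \<ge> 1" "t \<in> {a..b}"
  obtains i where "i < n" "node a b n i \<le> t" "t \<le> node a b n (Suc i)"
proof -
  \<comment> \<open>Minimality gives the lower bound: were \<open>t\<close> below the left node of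
    cell \<open>i\<close>, the preceding index would already qualify.\<close>
  define i where "i = (LEAST i. t \<le> node a b n (Suc i))"
  have ex: "t \<le> node a b n (Suc (n - 1))"
    using assms node_last[of n a b] by simp
  have le: "t \<le> node a b n (Suc i)"
    unfolding i_def by (rule LeastI[where P = "\<lambda>i. t \<le> node a b n (Suc i)", OF ex])
  have "i \<le> n - 1"
    unfolding i_def by (rule Least_le[where P = "\<lambda>i. t \<le> node a b n (Suc i)", OF ex])
  moreover have "node a b n i \<le> t"
  proof (cases i)
    case 0
    with assms show ?thesis by (simp add: node_0)
  next
    case (Suc j)
    have "\<not> t \<le> node a b n (Suc j)"
      using not_less_Least[of j "\<lambda>i. t \<le> node a b n (Suc i)"] Suc by (simp add: i_def)
    with Suc show ?thesis by simp
  qed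
  ultimately show ?thesis
    using that[of i] le assms by simp
qed

lemma peano_kernel_1: "a < b \<Longrightarrow> t \<in> {a..b} \<Longrightarrow> peano_kernel a b 1 t = (t - a) * (b - t) / 2"
  using peano_kernel_cell[of a b 1 0 t] by (simp add: node_def mesh_def)

text \<open>Let \<open>t\<close> split its cell into lengths \<open>u\<close> and \<open>v\<close>,
  with \<open>i\<close> cells to the left and \<open>j\<close> to the right. Then (t - a)(b - t)
  exceeds n u v by the nonnegative quantity i j (u + v)^2 + i v^2 + j u^2, because n = i + j +
  1.\<close>

lemma peano_kernel_le:
  assumes "a < b" "n \<ge> 1" "t \<in> {a..b}"
  shows "real n * peano_kernel a b n t \<le> peano_kernel a b 1 t"
proof -
  obtain i where i: "i < n" "node a b n i \<le> t" "t \<le> node a b n (Suc i)"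
    using cell_exists assms by blast
  define h where "h = mesh a b n"
  define u where "u = t - node a b n i"
  define v where "v = node a b n (Suc i) - t"
  define j where "j = n - 1 - i"
  have nn: "real n = real i + real j + 1"
    using i by (simp add: j_def)
  have hs: "u \<ge> 0" "v \<ge> 0" "u + v = h"
    using i by (auto simp: u_def v_def h_def node_Suc)
  have ta: "t - a = real i * (u + v) + u"
    unfolding hs(3) by (simp add: u_def node_def h_def)
  have "b - a = real n * h"
    using assms by (simp add: h_def mesh_def)
  then have tb: "b - t = real j * (u + v) + v"
    using ta hs(3) nn by (simp add: algebra_simps)
  have "(t - a) * (b - t) - real n * (u * v)
      = real i * real j * (u + v)\<^sup>2 + real i * v\<^sup>2 + real j * u\<^sup>2"
    unfolding ta tb nn by (simp add: power2_eq_square algebra_simps)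
  also have "\<dots> \<ge> 0"
    by simp
  finally have "real n * (u * v) \<le> (t - a) * (b - t)"
    by simp
  then show ?thesis
    using peano_kernel_1[of a b t] assms
    by (simp add: peano_kernel_cell[OF assms(1,2) i] u_def v_def del: One_nat_def)
qed

text \<open>The comparison is made in each coarse cell separately. With \<open>u\<close> the
  distance from its left node and \<open>h\<close> the fine mesh, u(2h - u) - 2u(h - u) = u^2 on the
  left half, and the right half is its mirror image; outside the coarse cell all three clipped
  products are 0.\<close>

lemma peano_kernel_double:
  assumes "a < b" "n \<ge> 1"
  shows "2 * peano_kernel a b (2 * n) t \<le> peano_kernel a b n t"
proof -
  define h where "h = mesh a b (2 * n)"
  let ?p = "\<lambda>m i. max 0 ((t - node a b m i) * (node a b m (Suc i) - t))"
  \<comment> \<open>Fine cells 2i and 2i + 1 together fill coarse cell i.\<close>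
  have cell: "2 * (?p (2 * n) (2 * i) + ?p (2 * n) (Suc (2 * i))) \<le> ?p n i" for i
  proof -
    define u where "u = t - node a b n i"
    have h: "h > 0" using mesh_pos[of a b "2 * n"] assms by (simp add: h_def)
    have mesh: "mesh a b n = 2 * h" using assms by (simp add: h_def mesh_def field_simps)
    have nodes: "t - node a b (2 * n) (2 * i) = u" "node a b (2 * n) (Suc (2 * i)) - t = h - u"
      "t - node a b (2 * n) (Suc (2 * i)) = u - h"
      "node a b (2 * n) (Suc (Suc (2 * i))) - t = 2 * h - u"
      "t - node a b n i = u" "node a b n (Suc i) - t = 2 * h - u"
      by (simp_all add: u_def node_def mesh flip: h_def) (simp_all add: algebra_simps)
    show ?thesis
      unfolding nodes
    proof -
      consider "u \<le> 0" | "0 \<le> u" "u \<le> h" | "h \<le> u" "u \<le> 2 * h" | "2 * h \<le> u"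
        by linarith
      then show "2 * (max 0 (u * (h - u)) + max 0 ((u - h) * (2 * h - u)))
          \<le> max 0 (u * (2 * h - u))"
      proof cases
        case 1
        with h have "u * (h - u) \<le> 0" "(u - h) * (2 * h - u) \<le> 0"
          by (auto intro!: mult_nonpos_nonneg)
        then show ?thesis by simp
      next
        case 2
        with h have "(u - h) * (2 * h - u) \<le> 0" "0 \<le> u * (h - u)"
          by (auto intro!: mult_nonpos_nonneg)
        moreover have "u * (2 * h - u) - 2 * (u * (h - u)) = u * u"
          by (simp add: algebra_simps)
        ultimately have "2 * (u * (h - u)) \<le> u * (2 * h - u)"
          using zero_le_square[of u] by linarith
        with \<open>(u - h) * (2 * h - u) \<le> 0\<close> \<open>0 \<le> u * (h - u)\<close> show ?thesis
          by (simp add: le_max_iff_disj)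
      next
        case 3
        with h have "u * (h - u) \<le> 0" "0 \<le> (u - h) * (2 * h - u)"
          by (auto intro!: mult_nonneg_nonpos)
        moreover have "u * (2 * h - u) - 2 * ((u - h) * (2 * h - u)) = (2 * h - u) * (2 * h - u)"
          by (simp add: algebra_simps)
        ultimately have "2 * ((u - h) * (2 * h - u)) \<le> u * (2 * h - u)"
          using zero_le_square[of "2 * h - u"] by linarith
        with \<open>u * (h - u) \<le> 0\<close> \<open>0 \<le> (u - h) * (2 * h - u)\<close> show ?thesis
          by (simp add: le_max_iff_disj)
      next
        case 4
        with h have "u * (h - u) \<le> 0" "(u - h) * (2 * h - u) \<le> 0"
          by (auto intro!: mult_nonneg_nonpos)
        then show ?thesis by simp
      qed
    qed
  qed
  have "(\<Sum>i<2 * m. ?p (2 * n) i) = (\<Sum>i<m. ?p (2 * n) (2 * i) + ?p (2 * n) (Suc (2 * i)))" for m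
    by (induction m) (simp_all add: algebra_simps)
  then have "2 * (\<Sum>i<2 * n. ?p (2 * n) i) \<le> (\<Sum>i<n. ?p n i)"
    using cell by (simp add: sum_distrib_left sum_mono)
  then show ?thesis
    by (simp add: peano_kernel_def)
qed

section \<open>Peano representation of the univariate remainder\<close>

text \<open>An interior node receives half its weight from each of its two cells, an end node only
  one half. In this form the rule can be handled cell by cell.\<close>

lemma primed_sum_eq:
  assumes "n \<ge> 1"
  shows "primed_sum n F = (\<Sum>i<n. (F i + F (Suc i)) / 2)"
proof -
  obtain m where n: "n = Suc m"
    using assms by (cases n) auto
  have *: "(\<Sum>i<Suc k. (F i + F (Suc i)) / 2) = F 0 / 2 + (\<Sum>i=1..k. F i) + F (Suc k) / 2" for k
    by (induction k) (simp_all add: field_simps)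
  have "primed_sum n F = F 0 / 2 + (\<Sum>i=1..m. if i = 0 \<or> i = n then F i / 2 else F i) + F n / 2"
    unfolding primed_sum_def n by (simp add: sum.atLeast_Suc_atMost)
  also have "(\<Sum>i=1..m. if i = 0 \<or> i = n then F i / 2 else F i) = (\<Sum>i=1..m. F i)"
    by (intro sum.cong) (auto simp: n)
  finally show ?thesis
    using *[of m] n by simp
qed

text \<open>Two integrations by parts in one: for p(t) = (t - c)(d - t)/2 one has p'' = -1, so p g'
  - p' g is an antiderivative of p g'' + g. At the ends p vanishes and p' equals (d - c)/2 and -(d -
  c)/2, which leaves the trapezium value.\<close>

lemma trapezium_cell_integral:
  fixes g g' g'' :: "real \<Rightarrow> real"
  assumes "c \<le> d"
    and g: "\<And>t. t \<in> {c..d} \<Longrightarrow> (g has_real_derivative g' t) (at t within {c..d})"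
    and g': "\<And>t. t \<in> {c..d} \<Longrightarrow> (g' has_real_derivative g'' t) (at t within {c..d})"
  shows "((\<lambda>t. (t - c) * (d - t) / 2 * g'' t + g t) has_integral (d - c) * ((g c + g d) / 2)) {c..d}"
proof -
  let ?F = "\<lambda>t. (t - c) * (d - t) / 2 * g' t - (c + d - 2 * t) / 2 * g t"
  have "(?F has_real_derivative (t - c) * (d - t) / 2 * g'' t + g t) (at t within {c..d})"
    if "t \<in> {c..d}" for t
  proof -
    have "((\<lambda>t. (t - c) * (d - t) / 2) has_real_derivative (c + d - 2 * t) / 2) (at t within {c..d})"
      by (auto intro!: derivative_eq_intros simp: field_simps)
    moreover have "((\<lambda>t. (c + d - 2 * t) / 2) has_real_derivative -1) (at t within {c..d})"
      by (auto intro!: derivative_eq_intros)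
    ultimately show ?thesis
      using DERIV_diff[OF DERIV_mult[OF _ g'[OF that]] DERIV_mult[OF _ g[OF that]]]
      by (fastforce simp: algebra_simps)
  qed
  then have "((\<lambda>t. (t - c) * (d - t) / 2 * g'' t + g t) has_integral ?F d - ?F c) {c..d}"
    using assms(1)
    by (intro fundamental_theorem_of_calculus)
      (auto simp: has_real_derivative_iff_has_vector_derivative)
  also have "?F d - ?F c = (d - c) * ((g c + g d) / 2)"
    by (simp add: field_simps)
  finally show ?thesis .
qed

lemma trapezium_remainder_peano:
  fixes g g' g'' :: "real \<Rightarrow> real"
  assumes "a < b" "n \<ge> 1"
    and g: "\<And>t. t \<in> {a..b} \<Longrightarrow> (g has_real_derivative g' t) (at t within {a..b})"
    and g': "\<And>t. t \<in> {a..b} \<Longrightarrow> (g' has_real_derivative g'' t) (at t within {a..b})"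
    and cont: "continuous_on {a..b} g''"
  shows "trapezium_remainder a b n g = - integral {a..b} (\<lambda>t. peano_kernel a b n t * g'' t)"
proof -
  let ?x = "node a b n"
  let ?H = "\<lambda>t. peano_kernel a b n t * g'' t + g t"
  have cell: "(?H has_integral mesh a b n * ((g (?x i) + g (?x (Suc i))) / 2)) {?x i..?x (Suc i)}"
    if "i < n" for i
  proof -
    have sub: "{?x i..?x (Suc i)} \<subseteq> {a..b}"
      using node_mem[of a b n i] node_mem[of a b n "Suc i"] that assms by auto
    have mono: "?x i \<le> ?x (Suc i)"
      using node_mono[OF assms(1,2)] by simp
    have "((\<lambda>t. (t - ?x i) * (?x (Suc i) - t) / 2 * g'' t + g t) has_integral
        (?x (Suc i) - ?x i) * ((g (?x i) + g (?x (Suc i))) / 2)) {?x i..?x (Suc i)}"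
    proof (rule trapezium_cell_integral[OF mono])
      fix t assume "t \<in> {?x i..?x (Suc i)}"
      with sub have t: "t \<in> {a..b}" by blast
      show "(g has_real_derivative g' t) (at t within {?x i..?x (Suc i)})"
        using g[OF t] sub by (rule has_field_derivative_subset)
      show "(g' has_real_derivative g'' t) (at t within {?x i..?x (Suc i)})"
        using g'[OF t] sub by (rule has_field_derivative_subset)
    qed
    also have "?x (Suc i) - ?x i = mesh a b n"
      by (simp add: node_Suc)
    finally show ?thesis
      by (rule has_integral_eq[rotated]) (simp add: peano_kernel_cell[OF assms(1,2) that])
  qed
  \<comment> \<open>The cells are glued from the left, one at a time; on each of them the kernel
    coincides with the parabola of the cell identity.\<close>
  have "(?H has_integral (\<Sum>i<m. mesh a b n * ((g (?x i) + g (?x (Suc i))) / 2))) {a..?x m}"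
    if "m \<le> n" for m
    using that
  proof (induction m)
    case 0
    show ?case
      unfolding node_0 atLeastAtMost_singleton lessThan_0 sum.empty by (rule has_integral_refl)
  next
    case (Suc m)
    have "a \<le> ?x m" "?x m \<le> ?x (Suc m)"
      using node_mono[of a b n 0 m] node_mono[of a b n m "Suc m"] assms by (auto simp: node_0)
    from has_integral_combine[OF this Suc.IH cell[of m]] Suc.prems show ?case
      by simp
  qed
  from this[of n] have "(?H has_integral trapezium a b n g) {a..b}"
    using assms by (simp add: node_last trapezium_def primed_sum_eq sum_distrib_left)
  then have "integral {a..b} ?H = trapezium a b n g"
    by (rule integral_unique)
  moreover have "continuous_on {a..b} g"
    using g by (rule DERIV_continuous_on)
  then have "integral {a..b} ?H
      = integral {a..b} (\<lambda>t. peano_kernel a b n t * g'' t) + integral {a..b} g"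
    using cont
    by (intro Henstock_Kurzweil_Integration.integral_add integrable_continuous_real
        continuous_on_mult continuous_on_peano_kernel)
  ultimately show ?thesis
    by (simp add: trapezium_remainder_def)
qed

section \<open>Continuity on the square, and moving the remainder under an integral\<close>

lemma square_eq_cbox: "square a b = cbox (a, a) (b, b)"
  by (simp add: square_def cbox_Pair_eq)

lemma continuous_on_square_slice:
  assumes "continuous_on (square a b) u"
  shows "y \<in> {a..b} \<Longrightarrow> continuous_on {a..b} (\<lambda>x. u (x, y))"
    and "x \<in> {a..b} \<Longrightarrow> continuous_on {a..b} (\<lambda>y. u (x, y))"
  by (rule continuous_on_compose2[OF assms]; auto simp: square_def intro!: continuous_intros)+

lemma continuous_on_square_integral:
  fixes u :: "real \<times> real \<Rightarrow> real"
  assumes "continuous_on (square a b) u"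
  shows "continuous_on {a..b} (\<lambda>x. integral {a..b} (\<lambda>y. u (x, y)))"
    and "continuous_on {a..b} (\<lambda>y. integral {a..b} (\<lambda>x. u (x, y)))"
proof -
  show "continuous_on {a..b} (\<lambda>x. integral {a..b} (\<lambda>y. u (x, y)))"
    using integral_continuous_on_param[of "{a..b}" a b "\<lambda>x y. u (x, y)"] assms
    by (simp add: square_def)
  have "continuous_on ({a..b} \<times> {a..b}) (\<lambda>(y, x). u (x, y))"
    unfolding case_prod_beta
    by (rule continuous_on_compose2[OF assms]) (auto simp: square_def intro!: continuous_intros)
  then show "continuous_on {a..b} (\<lambda>y. integral {a..b} (\<lambda>x. u (x, y)))"
    using integral_continuous_on_param[of "{a..b}" a b "\<lambda>y x. u (x, y)"] by simp
qed

lemma trapezium_diff: "trapezium a b n (\<lambda>x. g x - h x) = trapezium a b n g - trapezium a b n h"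
proof -
  have "primed_sum n (\<lambda>i. F i - G i) = primed_sum n F - primed_sum n G" for F G
    unfolding primed_sum_def sum_subtractf[symmetric]
    by (intro sum.cong) (auto simp: diff_divide_distrib)
  then show ?thesis
    by (simp add: trapezium_def right_diff_distrib)
qed

lemma continuous_on_trapezium:
  assumes "a < b" "n \<ge> 1" and "\<And>y. y \<in> {a..b} \<Longrightarrow> continuous_on S (\<lambda>x. u x y)"
  shows "continuous_on S (\<lambda>x. trapezium a b n (u x))"
  unfolding trapezium_def primed_sum_eq[OF assms(2)]
  using assms node_mem[of a b n] by (intro continuous_intros) auto

lemma integral_mult_trapezium:
  fixes k :: "real \<Rightarrow> real"
  assumes "a < b" "n \<ge> 1" and "\<And>x. x \<in> {a..b} \<Longrightarrow> (\<lambda>t. k t * u x t) integrable_on S"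
  shows "integral S (\<lambda>t. k t * trapezium a b n (\<lambda>x. u x t))
    = trapezium a b n (\<lambda>x. integral S (\<lambda>t. k t * u x t))"
proof -
  let ?x = "node a b n"
  have int: "(\<lambda>t. k t * u (?x i) t) integrable_on S" if "i \<le> n" for i
    using node_mem[of a b n i] assms that by auto
  have "integral S (\<lambda>t. k t * trapezium a b n (\<lambda>x. u x t))
      = integral S (\<lambda>t. \<Sum>i<n. mesh a b n / 2 * (k t * u (?x i) t + k t * u (?x (Suc i)) t))"
    by (simp add: trapezium_def primed_sum_eq[OF assms(2)] sum_distrib_left field_simps)
  also have "\<dots> = (\<Sum>i<n. integral S (\<lambda>t. mesh a b n / 2 * (k t * u (?x i) t + k t * u (?x (Suc i)) t)))"
    by (intro integral_sum integrable_on_mult_right Henstock_Kurzweil_Integration.integrable_add int) auto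
  also have "\<dots> = (\<Sum>i<n. mesh a b n / 2 *
      (integral S (\<lambda>t. k t * u (?x i) t) + integral S (\<lambda>t. k t * u (?x (Suc i)) t)))"
    by (intro sum.cong refl) (simp add: Henstock_Kurzweil_Integration.integral_add int)
  also have "\<dots> = trapezium a b n (\<lambda>x. integral S (\<lambda>t. k t * u x t))"
    by (simp add: trapezium_def primed_sum_eq[OF assms(2)] sum_distrib_left field_simps)
  finally show ?thesis .
qed

text \<open>The remainder in x is an integral minus a finite linear combination of values. The first
  part commutes with weighted integration in t by Fubini, the second by linearity. This allows the
  kernel representation in y to be followed by the one in x.\<close>

lemma trapezium_remainder_integral:
  fixes k :: "real \<Rightarrow> real" and u :: "real \<times> real \<Rightarrow> real"
  assumes "a < b" "n \<ge> 1" and k: "continuous_on {a..b} k" and u: "continuous_on (square a b) u"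
  shows "trapezium_remainder a b n (\<lambda>x. integral {a..b} (\<lambda>t. k t * u (x, t)))
    = integral {a..b} (\<lambda>t. k t * trapezium_remainder a b n (\<lambda>x. u (x, t)))"
proof -
  have ku: "continuous_on (square a b) (\<lambda>(x, t). k t * u (x, t))"
    unfolding case_prod_beta prod.collapse
    by (intro continuous_on_mult u continuous_on_compose2[OF k])
      (auto simp: square_def intro!: continuous_intros)
  have "integral {a..b} (\<lambda>x. integral {a..b} (\<lambda>t. k t * u (x, t)))
      = integral {a..b} (\<lambda>t. integral {a..b} (\<lambda>x. k t * u (x, t)))"
    using integral_swap_continuous[of a a b b "\<lambda>x t. k t * u (x, t)"] ku
    by (simp add: square_eq_cbox)
  also have "\<dots> = integral {a..b} (\<lambda>t. k t * integral {a..b} (\<lambda>x. u (x, t)))"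
    by simp
  finally have J: "integral {a..b} (\<lambda>x. integral {a..b} (\<lambda>t. k t * u (x, t)))
      = integral {a..b} (\<lambda>t. k t * integral {a..b} (\<lambda>x. u (x, t)))" .
  have Q: "integral {a..b} (\<lambda>t. k t * trapezium a b n (\<lambda>x. u (x, t)))
      = trapezium a b n (\<lambda>x. integral {a..b} (\<lambda>t. k t * u (x, t)))"
    using assms continuous_on_square_slice(2)[OF u]
    by (intro integral_mult_trapezium integrable_continuous_real continuous_intros) auto
  have "integral {a..b} (\<lambda>t. k t * trapezium_remainder a b n (\<lambda>x. u (x, t)))
      = integral {a..b} (\<lambda>t. k t * integral {a..b} (\<lambda>x. u (x, t)))
        - integral {a..b} (\<lambda>t. k t * trapezium a b n (\<lambda>x. u (x, t)))"
    unfolding trapezium_remainder_def right_diff_distrib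
    using assms continuous_on_square_slice(2)[OF u] continuous_on_square_integral(2)[OF u]
    by (intro Henstock_Kurzweil_Integration.integral_diff integrable_continuous_real
        continuous_on_mult continuous_on_trapezium) auto
  with J Q show ?thesis
    by (simp add: trapezium_remainder_def)
qed

section \<open>Tensor products of remainders and the remainder of the modified rule\<close>

text \<open>The tensor product R_l \<otimes> R_m of two univariate remainder functionals.\<close>

definition product_remainder ::
    "real \<Rightarrow> real \<Rightarrow> nat \<Rightarrow> nat \<Rightarrow> (real \<times> real \<Rightarrow> real) \<Rightarrow> real" where
  "product_remainder a b l m f =
     trapezium_remainder a b l (\<lambda>x. trapezium_remainder a b m (\<lambda>y. f (x, y)))"

lemma product_trapezium_eq:
  "product_trapezium a b n f = trapezium a b n (\<lambda>x. trapezium a b n (\<lambda>y. f (x, y)))"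
proof -
  have "primed_sum n (\<lambda>i. c * F i) = c * primed_sum n F" for c F
    by (auto simp: primed_sum_def sum_distrib_left intro!: sum.cong)
  then show ?thesis
    by (simp add: product_trapezium_def trapezium_def power2_eq_square)
qed

lemma trapezium_1: "trapezium a b 1 g = (b - a) / 2 * (g a + g b)"
  by (simp add: trapezium_def primed_sum_eq node_def mesh_def)

text \<open>Only the outer remainder and the integral of the inner one are expanded. The last term
  stays whole because for \<open>l = 1\<close> it consists of remainders along the left and right
  edges.\<close>

lemma product_remainder_expand:
  assumes "a < b" "m \<ge> 1" and f: "continuous_on (square a b) f"
  shows "product_remainder a b l m f = integral (square a b) f
    - integral {a..b} (\<lambda>x. trapezium a b m (\<lambda>y. f (x, y)))
    - trapezium a b l (\<lambda>x. trapezium_remainder a b m (\<lambda>y. f (x, y)))"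
proof -
  have "integral {a..b} (\<lambda>x. trapezium_remainder a b m (\<lambda>y. f (x, y)))
      = integral {a..b} (\<lambda>x. integral {a..b} (\<lambda>y. f (x, y)))
        - integral {a..b} (\<lambda>x. trapezium a b m (\<lambda>y. f (x, y)))"
    unfolding trapezium_remainder_def
    using assms continuous_on_square_slice(1)[OF f] continuous_on_square_integral(1)[OF f]
    by (intro Henstock_Kurzweil_Integration.integral_diff integrable_continuous_real
        continuous_on_trapezium) auto
  also have "integral {a..b} (\<lambda>x. integral {a..b} (\<lambda>y. f (x, y))) = integral (square a b) f"
    using integral_prod_continuous[of a a b b f] f
    by (simp add: square_eq_cbox)
  finally show ?thesis
    by (simp add: product_remainder_def trapezium_remainder_def[of a b l])
qed

text \<open>Put Q = I - R. Then I \<otimes> R_n + R_n \<otimes> I - R_n \<otimes> R_n is I \<otimes>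
  I - Q_n \<otimes> Q_n, the error of the product rule. Replacing I by R_1 = I - Q_1 in the first
  two terms subtracts Q_1 \<otimes> R_n + R_n \<otimes> Q_1, and this is exactly the boundary
  correction, since Q_1 only sees end points.\<close>

lemma S_plus_remainder_eq:
  assumes "a < b" "n \<ge> 1" and f: "continuous_on (square a b) f"
  shows "S_plus_remainder a b n f =
    product_remainder a b 1 n f + product_remainder a b n 1 f - product_remainder a b n n f"
proof -
  have ab: "a \<in> {a..b}" "b \<in> {a..b}"
    using assms by auto
  \<comment> \<open>Facts \<open>A\<close> and \<open>B\<close> give the lower and upper edges from
    Q_1 in y; fact \<open>E\<close> gives the left and right edges from Q_1 in x.\<close>
  have A: "integral {a..b} (\<lambda>x. trapezium a b 1 (\<lambda>y. f (x, y)))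
      = (b - a) / 2 * (integral {a..b} (\<lambda>x. f (x, a)) + integral {a..b} (\<lambda>x. f (x, b)))"
    unfolding trapezium_1
    using continuous_on_square_slice(1)[OF f] ab
    by (simp add: Henstock_Kurzweil_Integration.integral_add integrable_continuous_real)
  have B: "trapezium a b n (\<lambda>x. trapezium a b 1 (\<lambda>y. f (x, y)))
      = (b - a) / 2 * (trapezium a b n (\<lambda>x. f (x, a)) + trapezium a b n (\<lambda>x. f (x, b)))"
    unfolding trapezium_1
    by (simp add: trapezium_def primed_sum_eq[OF assms(2)] sum_distrib_left sum.distrib[symmetric]
        algebra_simps add_divide_distrib)
  have C: "trapezium a b n (\<lambda>x. trapezium_remainder a b m (\<lambda>y. f (x, y)))
      = trapezium a b n (\<lambda>x. integral {a..b} (\<lambda>y. f (x, y)))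
        - trapezium a b n (\<lambda>x. trapezium a b m (\<lambda>y. f (x, y)))" for m
    unfolding trapezium_remainder_def by (rule trapezium_diff)
  have E: "trapezium a b 1 (\<lambda>x. trapezium_remainder a b n (\<lambda>y. f (x, y))) = (b - a) / 2 *
      (trapezium_remainder a b n (\<lambda>y. f (a, y)) + trapezium_remainder a b n (\<lambda>y. f (b, y)))"
    by (rule trapezium_1)
  show ?thesis
    unfolding product_remainder_expand[OF assms(1) order_refl f] product_remainder_expand[OF assms]
      S_plus_remainder_def S_plus_def product_trapezium_eq A C B E
    unfolding trapezium_remainder_def
    by (simp add: algebra_simps)
qed

section \<open>Integral representations with the mixed derivative of order (2,2)\<close>

text \<open>These are the links of the chain f, D^{0,1}f, D^{0,2}f, D^{1,2}f, D^{2,2}f, which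
  follows the order of differentiation in \<open>mixed_deriv\<close>: first y, then x.\<close>

lemma C22_derivatives:
  assumes "f \<in> C22 a b"
  shows "\<lbrakk>x \<in> {a..b}; y \<in> {a..b}; j < 2\<rbrakk> \<Longrightarrow> ((\<lambda>t. mixed_deriv a b 0 j f (x, t)) has_real_derivative
        mixed_deriv a b 0 (Suc j) f (x, y)) (at y within {a..b})"
    and "\<lbrakk>x \<in> {a..b}; y \<in> {a..b}; i < 2\<rbrakk> \<Longrightarrow> ((\<lambda>t. mixed_deriv a b i 2 f (t, y)) has_real_derivative
        mixed_deriv a b (Suc i) 2 f (x, y)) (at x within {a..b})"
    and "\<lbrakk>i \<le> 2; j \<le> 2\<rbrakk> \<Longrightarrow> continuous_on (square a b) (mixed_deriv a b i j f)"
proof -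
  have "mixed_deriv_exists a b 2 2 f"
    using assms by (simp add: C22_def)
  then have y: "j < 2 \<Longrightarrow> y_differentiable a b (mixed_deriv a b 0 j f)"
    and x: "i < 2 \<Longrightarrow> x_differentiable a b (mixed_deriv a b i 2 f)" for i j
    by (auto simp: mixed_deriv_exists_def)
  show "((\<lambda>t. mixed_deriv a b 0 j f (x, t)) has_real_derivative
        mixed_deriv a b 0 (Suc j) f (x, y)) (at y within {a..b})"
    if "x \<in> {a..b}" "y \<in> {a..b}" "j < 2"
  proof -
    have "mixed_deriv a b 0 (Suc j) f (x, y)
        = vector_derivative (\<lambda>t. mixed_deriv a b 0 j f (x, t)) (at y within {a..b})"
      by (simp add: mixed_deriv_def partial_y_def)
    with y[OF that(3)] that show ?thesis
      by (auto simp: y_differentiable_def has_real_derivative_iff_has_vector_derivative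
          vector_derivative_works)
  qed
  show "((\<lambda>t. mixed_deriv a b i 2 f (t, y)) has_real_derivative
        mixed_deriv a b (Suc i) 2 f (x, y)) (at x within {a..b})"
    if "x \<in> {a..b}" "y \<in> {a..b}" "i < 2"
  proof -
    have "mixed_deriv a b (Suc i) 2 f (x, y)
        = vector_derivative (\<lambda>t. mixed_deriv a b i 2 f (t, y)) (at x within {a..b})"
      by (simp add: mixed_deriv_def partial_x_def)
    with x[OF that(3)] that show ?thesis
      by (auto simp: x_differentiable_def has_real_derivative_iff_has_vector_derivative
          vector_derivative_works)
  qed
  show "continuous_on (square a b) (mixed_deriv a b i j f)" if "i \<le> 2" "j \<le> 2"
    using assms that by (simp add: C22_def)
qed

lemma continuous_on_kernel_product:
  assumes "continuous_on (square a b) u"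
  shows "continuous_on (square a b)
    (\<lambda>p. peano_kernel a b l (fst p) * peano_kernel a b m (snd p) * u p)"
  by (intro continuous_on_mult assms continuous_on_compose2[OF continuous_on_peano_kernel[of UNIV]])
    (auto intro!: continuous_intros)

text \<open>The kernel representation is applied to every slice in y, the remainder in x is moved
  under the integral, and the representation is applied again in x. The two minus signs
  cancel.\<close>

lemma product_remainder_peano:
  assumes "a < b" "l \<ge> 1" "m \<ge> 1" and f: "f \<in> C22 a b"
  shows "product_remainder a b l m f = integral (square a b)
    (\<lambda>p. peano_kernel a b l (fst p) * peano_kernel a b m (snd p) * mixed_deriv a b 2 2 f p)"
proof -
  let ?k = "peano_kernel a b" and ?D = "\<lambda>i j. mixed_deriv a b i j f"
  have D00: "?D 0 0 = f"
    by (simp add: mixed_deriv_def)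
  have c: "continuous_on (square a b) (?D 0 2)" "continuous_on (square a b) (?D 2 2)"
    by (simp_all add: C22_derivatives(3)[OF f])
  have y: "trapezium_remainder a b m (\<lambda>y. f (x, y)) = - integral {a..b} (\<lambda>t. ?k m t * ?D 0 2 (x, t))"
    if "x \<in> {a..b}" for x
    using C22_derivatives(1)[OF f that, of _ 0] C22_derivatives(1)[OF f that, of _ 1]
      continuous_on_square_slice(2)[OF c(1) that] assms
    by (intro trapezium_remainder_peano[where g' = "\<lambda>t. ?D 0 1 (x, t)"])
      (simp_all add: D00 numeral_2_eq_2)
  have x: "trapezium_remainder a b l (\<lambda>x. ?D 0 2 (x, t)) = - integral {a..b} (\<lambda>s. ?k l s * ?D 2 2 (s, t))"
    if "t \<in> {a..b}" for t
    using C22_derivatives(2)[OF f _ that, of _ 0] C22_derivatives(2)[OF f _ that, of _ 1]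
      continuous_on_square_slice(1)[OF c(2) that] assms
    by (intro trapezium_remainder_peano[where g' = "\<lambda>s. ?D 1 2 (s, t)"])
      (simp_all add: numeral_2_eq_2)
  \<comment> \<open>The formula for the inner remainder holds only for x in [a,b]; the outer
    remainder is unfolded to show that it uses no other values.\<close>
  have "product_remainder a b l m f
      = trapezium_remainder a b l (\<lambda>x. - integral {a..b} (\<lambda>t. ?k m t * ?D 0 2 (x, t)))"
    unfolding product_remainder_def trapezium_remainder_def[of a b l] trapezium_def[of a b l]
      primed_sum_eq[OF assms(2)]
    using y node_mem[of a b l] assms
    by (intro arg_cong2[where f = "(-)"] arg_cong2[where f = "(*)"] sum.cong integral_cong refl) auto
  \<comment> \<open>The sign goes into the weight, so that the exchange applies with weight
    \<open>- ?k m t\<close>.\<close>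
  also have "\<dots> = trapezium_remainder a b l (\<lambda>x. integral {a..b} (\<lambda>t. - ?k m t * ?D 0 2 (x, t)))"
    by simp
  also have "\<dots> = integral {a..b} (\<lambda>t. - ?k m t * trapezium_remainder a b l (\<lambda>x. ?D 0 2 (x, t)))"
    using assms c by (intro trapezium_remainder_integral continuous_on_minus continuous_on_peano_kernel)
  also have "\<dots> = integral {a..b} (\<lambda>t. integral {a..b} (\<lambda>s. ?k l s * ?k m t * ?D 2 2 (s, t)))"
    by (intro integral_cong) (simp add: x integral_mult_right[symmetric] mult_ac del: integral_mult_right)
  also have "\<dots> = integral {a..b} (\<lambda>s. integral {a..b} (\<lambda>t. ?k l s * ?k m t * ?D 2 2 (s, t)))"
    using integral_swap_continuous[of a a b b "\<lambda>s t. ?k l s * ?k m t * ?D 2 2 (s, t)"]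
      continuous_on_kernel_product[OF c(2), of l m]
    by (simp add: square_eq_cbox case_prod_beta)
  also have "\<dots> = integral (square a b) (\<lambda>p. ?k l (fst p) * ?k m (snd p) * ?D 2 2 p)"
    using integral_prod_continuous[of a a b b "\<lambda>p. ?k l (fst p) * ?k m (snd p) * ?D 2 2 p"]
      continuous_on_kernel_product[OF c(2), of l m]
    by (simp add: square_eq_cbox case_prod_beta)
  finally show ?thesis .
qed

section \<open>The kernel of the modified rule and its bounds\<close>

definition S_plus_kernel :: "real \<Rightarrow> real \<Rightarrow> nat \<Rightarrow> real \<times> real \<Rightarrow> real" where
  "S_plus_kernel a b n = (\<lambda>(s, t). peano_kernel a b 1 s * peano_kernel a b n t
     + peano_kernel a b n s * peano_kernel a b 1 t - peano_kernel a b n s * peano_kernel a b n t)"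

lemma continuous_on_S_plus_kernel: "continuous_on S (S_plus_kernel a b n)"
  unfolding S_plus_kernel_def case_prod_beta
  by (intro continuous_intros continuous_on_compose2[OF continuous_on_peano_kernel[of UNIV]]) auto

lemma S_plus_remainder_peano:
  assumes "a < b" "n \<ge> 1" and f: "f \<in> C22 a b"
  shows "S_plus_remainder a b n f
    = integral (square a b) (\<lambda>p. S_plus_kernel a b n p * mixed_deriv a b 2 2 f p)"
proof -
  have "continuous_on (square a b) f"
    using C22_derivatives(3)[OF f, of 0 0] by (simp add: mixed_deriv_def)
  from S_plus_remainder_eq[OF assms(1,2) this]
  show ?thesis
    using continuous_on_kernel_product[OF C22_derivatives(3)[OF f, of 2 2]] assms
    by (simp add: product_remainder_peano S_plus_kernel_def case_prod_beta square_eq_cbox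
        ring_distribs integrable_continuous Henstock_Kurzweil_Integration.integral_add
        Henstock_Kurzweil_Integration.integral_diff
        Henstock_Kurzweil_Integration.integrable_add
        del: One_nat_def)
qed

text \<open>The first two bounds rest on a form of the kernel that is visibly monotone in k_m. The
  third compensates for the sign of D^{2,2}f being assumed on the open square only.\<close>

lemma S_plus_kernel_bounds:
  assumes "a < b" "n \<ge> 1" and p: "p \<in> square a b"
  shows "0 \<le> S_plus_kernel a b n p"
    and "S_plus_kernel a b (2 * n) p
      \<le> (1 / 2 + 1 / (4 * (2 * real n - 1))) * S_plus_kernel a b n p"
    and "p \<notin> {a<..<b} \<times> {a<..<b} \<Longrightarrow> S_plus_kernel a b n p = 0"
proof -
  obtain s t where st: "p = (s, t)" "s \<in> {a..b}" "t \<in> {a..b}"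
    using p by (auto simp: square_def)
  define k where "k = peano_kernel a b"
  have nonneg: "k m r \<ge> 0" for m r
    by (simp add: k_def peano_kernel_nonneg)
  have n_le: "real n * k n r \<le> k 1 r" if "r \<in> {a..b}" for r
    using peano_kernel_le assms that by (simp add: k_def)
  have le: "k n r \<le> k 1 r" if "r \<in> {a..b}" for r
    using mult_right_mono[of 1 "real n" "k n r"] nonneg[of n r] n_le[OF that] assms by simp
  have half: "k (2 * n) r \<le> k n r / 2" for r
    using peano_kernel_double[of a b n r] assms by (simp add: k_def)
  \<comment> \<open>As k_m \<le> k_1, both factors of the subtracted product are nonnegative and
    decrease as k_m grows.\<close>
  have W: "S_plus_kernel a b m p = k 1 s * k 1 t - (k 1 s - k m s) * (k 1 t - k m t)" for m
    by (simp add: S_plus_kernel_def st k_def algebra_simps)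
  have "(k 1 s - k n s) * (k 1 t - k n t) \<le> k 1 s * k 1 t"
    using le[of s] le[of t] nonneg st by (intro mult_mono) auto
  then show "0 \<le> S_plus_kernel a b n p"
    by (simp add: W)
  have "(k 1 s - k n s / 2) * (k 1 t - k n t / 2) \<le> (k 1 s - k (2 * n) s) * (k 1 t - k (2 * n) t)"
    using le[OF st(2)] le[OF st(3)] half[of s] half[of t] nonneg[of n s] nonneg[of n t]
    by (intro mult_mono) linarith+
  then have "S_plus_kernel a b (2 * n) p \<le> (k 1 s * k n t + k n s * k 1 t) / 2 - k n s * k n t / 4"
    by (simp add: W field_simps)
  also have "\<dots> \<le> (1 / 2 + 1 / (4 * (2 * real n - 1))) * S_plus_kernel a b n p"
  proof -
    \<comment> \<open>Let A be the sum of the two mixed products and B = k_n(s) k_n(t). The claim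
      A/2 - B/4 \<le> c (A - B) has the slack (A - 2nB)/(4(2n - 1)), and n k_n \<le> k_1 in each
      variable gives A \<ge> 2nB. The constant c is the one for which equality holds at A =
      2nB.\<close>
    have "real n * k n s * k n t \<le> k 1 s * k n t" "real n * k n t * k n s \<le> k 1 t * k n s"
      using n_le st nonneg by (auto intro!: mult_right_mono)
    then have "0 \<le> (k 1 s * k n t + k n s * k 1 t - 2 * real n * (k n s * k n t))
        / (4 * (2 * real n - 1))"
      using assms by (intro divide_nonneg_pos) (auto simp: algebra_simps)
    also have "\<dots> = (1 / 2 + 1 / (4 * (2 * real n - 1))) * S_plus_kernel a b n p
        - ((k 1 s * k n t + k n s * k 1 t) / 2 - k n s * k n t / 4)"
    proof -
      \<comment> \<open>With the denominator as the variable and \<open>n\<close> expressed through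
        it, a single nonzero atom has to be cleared.\<close>
      define d where "d = 4 * (2 * real n - 1)"
      have d: "d \<noteq> 0" "real n = (d + 4) / 8"
        using assms by (auto simp: d_def)
      show ?thesis
        unfolding W d_def[symmetric] unfolding d(2) using d(1) by (simp add: field_simps)
    qed
    finally show ?thesis by simp
  qed
  finally show "S_plus_kernel a b (2 * n) p
      \<le> (1 / 2 + 1 / (4 * (2 * real n - 1))) * S_plus_kernel a b n p" .
  show "S_plus_kernel a b n p = 0" if "p \<notin> {a<..<b} \<times> {a<..<b}"
  proof -
    have "k 1 a = 0" "k 1 b = 0"
      using peano_kernel_1[of a b a] peano_kernel_1[of a b b] assms by (simp_all add: k_def)
    moreover have "s = a \<or> s = b \<or> t = a \<or> t = b"
      using that st by auto
    ultimately have "k 1 s = 0 \<or> k 1 t = 0"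
      by auto
    moreover have "k 1 r = 0 \<Longrightarrow> k n r = 0" if "r \<in> {a..b}" for r
      using le[OF that] nonneg[of n r] by simp
    ultimately show ?thesis
      using st(2,3) by (auto simp: W)
  qed
qed

section \<open>The two estimates\<close>

theorem theorem2:
  fixes a b :: real and n :: nat and f :: "real \<times> real \<Rightarrow> real"
  assumes "a < b" and "n \<ge> 1" and "f \<in> C22_one_sign a b"
  shows "\<bar>S_plus_remainder a b (2 * n) f\<bar>
           \<le> (1 / 2 + 1 / (4 * (2 * real n - 1))) * \<bar>S_plus_remainder a b n f\<bar>
       \<and> \<bar>S_plus_remainder a b (2 * n) f\<bar>
           \<le> (4 * real n - 1) / (4 * real n - 3) * \<bar>S_plus a b (2 * n) f - S_plus a b n f\<bar>"
proof -
  let ?D = "mixed_deriv a b 2 2 f" and ?W = "S_plus_kernel a b"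
  define c where "c = 1 / 2 + 1 / (4 * (2 * real n - 1))"
  have f: "f \<in> C22 a b"
    using assms by (simp add: C22_one_sign_def)
  have cont: "continuous_on (square a b) ?D"
    by (simp add: C22_derivatives(3)[OF f])
  \<comment> \<open>The factor \<open>\<sigma>\<close> is the sign of D^{2,2}f and merges the two
    cases.\<close>
  obtain \<sigma> :: real where \<sigma>: "\<bar>\<sigma>\<bar> = 1" "\<And>p. p \<in> {a<..<b} \<times> {a<..<b} \<Longrightarrow> 0 \<le> \<sigma> * ?D p"
  proof -
    from assms(3) consider "\<forall>p\<in>{a<..<b} \<times> {a<..<b}. ?D p \<ge> 0" | "\<forall>p\<in>{a<..<b} \<times> {a<..<b}. ?D p \<le> 0"
      by (auto simp: C22_one_sign_def)
    then show ?thesis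
      using that[of 1] that[of "-1"] by cases auto
  qed
  have R: "\<sigma> * S_plus_remainder a b m f = integral (square a b) (\<lambda>p. \<sigma> * (?W m p * ?D p))"
    and int: "(\<lambda>p. \<sigma> * (?W m p * ?D p)) integrable_on square a b" if "m \<ge> 1" for m
  proof -
    show "\<sigma> * S_plus_remainder a b m f = integral (square a b) (\<lambda>p. \<sigma> * (?W m p * ?D p))"
      by (simp add: S_plus_remainder_peano[OF assms(1) that f])
    show "(\<lambda>p. \<sigma> * (?W m p * ?D p)) integrable_on square a b"
      using cont unfolding square_eq_cbox
      by (intro integrable_continuous continuous_intros continuous_on_S_plus_kernel)
  qed
  \<comment> \<open>On the boundary the kernel is 0, so the sign of the derivative there does not
    matter.\<close>
  have pointwise: "0 \<le> \<sigma> * (?W m p * ?D p)" if "m \<ge> 1" "p \<in> square a b" for m p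
  proof (cases "p \<in> {a<..<b} \<times> {a<..<b}")
    case True
    then show ?thesis
      using mult_nonneg_nonneg[OF S_plus_kernel_bounds(1)[OF assms(1) that] \<sigma>(2)]
      by (simp add: mult_ac)
  next
    case False
    then show ?thesis
      using S_plus_kernel_bounds(3)[OF assms(1) that] by simp
  qed
  \<comment> \<open>The integrand has one sign, so the absolute value costs nothing and the first
    estimate becomes a pointwise comparison of kernels.\<close>
  have abs_R: "\<bar>S_plus_remainder a b m f\<bar> = integral (square a b) (\<lambda>p. \<sigma> * (?W m p * ?D p))"
    if "m \<ge> 1" for m
  proof -
    have "\<bar>S_plus_remainder a b m f\<bar> = \<bar>\<sigma> * S_plus_remainder a b m f\<bar>"
      using \<sigma>(1) by (simp add: abs_mult)
    also have "\<dots> = \<sigma> * S_plus_remainder a b m f"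
      using Henstock_Kurzweil_Integration.integral_nonneg[OF int[OF that]] pointwise that
      by (simp add: R)
    finally show ?thesis
      using R that by simp
  qed
  have "\<sigma> * (?W (2 * n) p * ?D p) \<le> c * (\<sigma> * (?W n p * ?D p))" if p: "p \<in> square a b" for p
  proof (cases "p \<in> {a<..<b} \<times> {a<..<b}")
    case True
    then show ?thesis
      using mult_right_mono[OF S_plus_kernel_bounds(2)[OF assms(1,2) p] \<sigma>(2)]
      by (simp add: c_def mult_ac)
  next
    case False
    then show ?thesis
      using S_plus_kernel_bounds(3)[of a b n p] S_plus_kernel_bounds(3)[of a b "2 * n" p] assms p
      by simp
  qed
  then have "integral (square a b) (\<lambda>p. \<sigma> * (?W (2 * n) p * ?D p))
      \<le> integral (square a b) (\<lambda>p. c * (\<sigma> * (?W n p * ?D p)))"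
    using assms(2) by (intro integral_le int integrable_on_mult_right) auto
  then have first: "\<bar>S_plus_remainder a b (2 * n) f\<bar> \<le> c * \<bar>S_plus_remainder a b n f\<bar>"
    using assms(2) by (simp add: abs_R)
  have n: "real n \<ge> 1"
    using assms(2) by simp
  have c: "c = (4 * real n - 1) / (4 * (2 * real n - 1))"
    using n by (simp add: c_def field_simps)
  have "S_plus a b (2 * n) f - S_plus a b n f = S_plus_remainder a b n f - S_plus_remainder a b (2 * n) f"
    by (simp add: S_plus_remainder_def)
  then have "\<bar>S_plus_remainder a b n f\<bar>
      \<le> \<bar>S_plus a b (2 * n) f - S_plus a b n f\<bar> + \<bar>S_plus_remainder a b (2 * n) f\<bar>"
    by linarith
  then have "c * \<bar>S_plus_remainder a b n f\<bar>
      \<le> c * (\<bar>S_plus a b (2 * n) f - S_plus a b n f\<bar> + \<bar>S_plus_remainder a b (2 * n) f\<bar>)"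
    using n by (intro mult_left_mono) (auto simp: c_def)
  \<comment> \<open>The remainder for 2n is absorbed on the left; 1 - c is positive because 4n - 3 >
    0.\<close>
  with first have "(1 - c) * \<bar>S_plus_remainder a b (2 * n) f\<bar>
      \<le> c * \<bar>S_plus a b (2 * n) f - S_plus a b n f\<bar>"
    by (simp add: algebra_simps)
  moreover have "1 - c = (4 * real n - 3) / (4 * (2 * real n - 1))"
    using n by (simp add: c field_simps)
  ultimately have "(4 * real n - 3) * \<bar>S_plus_remainder a b (2 * n) f\<bar>
      \<le> (4 * real n - 1) * \<bar>S_plus a b (2 * n) f - S_plus a b n f\<bar>"
    using n by (simp add: c divide_le_cancel)
  then have "\<bar>S_plus_remainder a b (2 * n) f\<bar>
      \<le> (4 * real n - 1) / (4 * real n - 3) * \<bar>S_plus a b (2 * n) f - S_plus a b n f\<bar>"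
    using n by (simp add: field_simps)
  with first show ?thesis
    by (simp add: c_def)
qed

end
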